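(* For any $n,k\ge 1$ and any $\mathbf z_n\in[k]^n$, $$\mathcal C^{A}_{\mathrm{DNML}}(\mathbf z_n,k)=\prod_{1\le a\le b\le k}C_{\mathrm{MN}}(n_{ab}(\mathbf z_n),2),$$ where, for an integer $m\ge 0$, $$C_{\mathrm{MN}}(m,2)=\sum_{t=0}^m\frac{m!}{t!(m-t)!}\left(\frac tm\right)^t\left(\frac{m-t}{m}\right)^{m-t}.$$
   Context: A network on $n$ nodes is an undirected simple graph, identified with its symmetric adjacency matrix $\mathbf x_{n\times n}=(x_{ij})\in\{0,1\}^{n\times n}$ with zero diagonal; sums $\sum_{\mathbf x_{n\times n}}$ run over all networks on $n$ nodes. $[k]=\{1,\dots,k\}$ and $\mathcal P^k=\{P\in[0,1]^{k\times k}: P\text{ symmetric}\}$. For $\mathbf z_n\in[k]^n$ let $n_a(\mathbf z_n)=\sum_{i=1}^n \mathbf 1\{z_i=a\}$; for $a\ne b$ let $o_{ab}(\mathbf x_{n\times n},\mathbf z_n)=\sum_{i,j=1}^n x_{ij}\mathbf 1\{z_i=a,z_j=b\}$ and $n_{ab}(\mathbf z_n)=n_a(\mathbf z_n)n_b(\mathbf z_n)$; let $o_{aa}(\mathbf x_{n\times n},\mathbf z_n)=\sum_{i<j}x_{ij}\mathbf 1\{z_i=a,z_j=a\}$ and $n_{aa}(\mathbf z_n)=\tfrac12 n_a(\mathbf z_n)(n_a(\mathbf z_n)-1)$. Put $$\mathbb P_P(\mathbf x_{n\times n}\mid\mathbf z_n)=\prod_{1\le a\le b\le k}P_{ab}^{o_{ab}(\mathbf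 x_{n\times n},\mathbf z_n)}(1-P_{ab})^{n_{ab}(\mathbf z_n)-o_{ab}(\mathbf x_{n\times n},\mathbf z_n)}$$ and $$\mathcal C^{A}_{\mathrm{DNML}}(\mathbf z_n,k)=\sum_{\mathbf x_{n\times n}}\sup_{P\in\mathcal P^k}\mathbb P_P(\mathbf x_{n\times n}\mid\mathbf z_n).$$ Convention: any expression raised to the power $0$ equals $1$ (including $0^0$ and $(0/0)^0$), so $C_{\mathrm{MN}}(0,2)=1$. *)

theory Defs
  imports Complex_Main "HOL-Library.FuncSet"
begin

text \<open>Vectors and matrices are functions of indices starting at 1. Networks and matrices in
  $\mathcal{P}^k$ are extensional, so that each mathematical object has exactly one representative.\<close>

definition networks :: "nat \<Rightarrow> (nat \<Rightarrow> nat \<Rightarrow> nat) set" where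
  "networks n = {x \<in> {1..n} \<rightarrow>\<^sub>E ({1..n} \<rightarrow>\<^sub>E {0, 1}).
     (\<forall>i\<in>{1..n}. \<forall>j\<in>{1..n}. x i j = x j i) \<and> (\<forall>i\<in>{1..n}. x i i = 0)}"

definition prob_matrices :: "nat \<Rightarrow> (nat \<Rightarrow> nat \<Rightarrow> real) set" where
  "prob_matrices k = {P \<in> {1..k} \<rightarrow>\<^sub>E ({1..k} \<rightarrow>\<^sub>E {0..1}).
     \<forall>a\<in>{1..k}. \<forall>b\<in>{1..k}. P a b = P b a}"

definition block_size :: "nat \<Rightarrow> (nat \<Rightarrow> nat) \<Rightarrow> nat \<Rightarrow> nat" where
  "block_size n z a = (\<Sum>i=1..n. of_bool (z i = a))"

definition edge_count :: "nat \<Rightarrow> (nat \<Rightarrow> nat \<Rightarrow> nat) \<Rightarrow> (nat \<Rightarrow> nat) \<Rightarrow> nat \<Rightarrow> nat \<Rightarrow> nat" where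
  "edge_count n x z a b =
     (if a = b then \<Sum>i=1..n. \<Sum>j\<in>{i<..n}. x i j * of_bool (z i = a \<and> z j = a)
      else \<Sum>i=1..n. \<Sum>j=1..n. x i j * of_bool (z i = a \<and> z j = b))"

text \<open>The natural-number operations below are exact: $m (m - 1)$ is even (and is $0$ for $m = 0$).\<close>

definition pair_count :: "nat \<Rightarrow> (nat \<Rightarrow> nat) \<Rightarrow> nat \<Rightarrow> nat \<Rightarrow> nat" where
  "pair_count n z a b =
     (if a = b then block_size n z a * (block_size n z a - 1) div 2
      else block_size n z a * block_size n z b)"

text \<open>The exponent subtraction does not truncate: \<open>edge_count n x z a b \<le> pair_count n z a b\<close>
  for every network \<open>x\<close>.\<close>

definition sbm_prob ::
    "nat \<Rightarrow> nat \<Rightarrow> (nat \<Rightarrow> nat \<Rightarrow> real) \<Rightarrow> (nat \<Rightarrow> nat \<Rightarrow> nat) \<Rightarrow> (nat \<Rightarrow> nat) \<Rightarrow> real" where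
  "sbm_prob n k P x z =
     (\<Prod>a=1..k. \<Prod>b=a..k. P a b ^ edge_count n x z a b *
        (1 - P a b) ^ (pair_count n z a b - edge_count n x z a b))"

text \<open>The set under the supremum is nonempty and contained in the unit interval, so the real
  supremum is the genuine one.\<close>

definition C_DNML :: "nat \<Rightarrow> (nat \<Rightarrow> nat) \<Rightarrow> nat \<Rightarrow> real" where
  "C_DNML n z k = (\<Sum>x\<in>networks n. SUP P\<in>prob_matrices k. sbm_prob n k P x z)"

text \<open>$C_{\mathrm{MN}}(m, 2)$. For $m = 0$ the only summand involves $(0/0)^0$, which is $1$ in HOL
  because any power with exponent $0$ is.\<close>

definition C_MN2 :: "nat \<Rightarrow> real" where
  "C_MN2 m = (\<Sum>t=0..m. fact m / (fact t * fact (m - t)) *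
     (real t / real m) ^ t * (real (m - t) / real m) ^ (m - t))"

end

theory Submission
  imports Defs
begin

text \<open>Choosing an ordered representative for each pair of nodes (smaller block first, ties broken
  by node index) splits a network into independent edge sets, one for each pair of blocks
  \<open>a \<le> b\<close>, and the likelihood depends on each part only through its cardinality. The supremum
  over \<open>P\<close> is attained entrywise at \<open>t / m\<close> (\<open>t\<close> edges out of \<open>m\<close> possible ones), so that the sum
  over networks distributes over the product, and grouping edge sets by cardinality produces the
  binomial coefficients.\<close>

section \<open>Maximum of the Bernoulli likelihood\<close>

text \<open>Raise \<open>1 + u \<le> exp u\<close> at \<open>u = y / t - 1\<close> to the power
  \<open>t\<close>. Equality holds at \<open>y = t\<close>, so the bound is sharp enough to locate
  the likelihood maximum without calculus.\<close>

lemma power_le_exp_mult_power: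
  fixes y :: real
  assumes "0 \<le> y"
  shows "y ^ t \<le> exp (y - real t) * real t ^ t"
proof (cases "t = 0")
  case False
  then have t: "real t > 0" by simp
  have "y / real t \<le> exp (y / real t - 1)"
    using exp_ge_add_one_self[of "y / real t - 1"] by simp
  then have "(y / real t) ^ t \<le> exp (y / real t - 1) ^ t"
    using assms t by (intro power_mono) auto
  also have "\<dots> = exp (y - real t)"
    using t by (simp add: exp_of_nat_mult[symmetric] algebra_simps)
  finally show ?thesis
    using t by (simp add: power_divide field_simps)
qed (use assms in simp)

text \<open>After scaling by \<open>m ^ m\<close>, bound the two factors by the previous lemma with
  \<open>y = q * m\<close> and \<open>y = (1 - q) * m\<close>. The two exponents of
  \<open>exp\<close> add up to 0, so \<open>q\<close> disappears. For \<open>m = 0\<close> both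
  sides are 1.\<close>

lemma bernoulli_likelihood_le:
  fixes q :: real
  assumes "0 \<le> q" "q \<le> 1" "t \<le> m"
  shows "q ^ t * (1 - q) ^ (m - t) \<le> (real t / real m) ^ t * (1 - real t / real m) ^ (m - t)"
proof (cases "m = 0")
  case False
  then have m: "real m > 0" by simp
  have "(q * m) ^ t * ((1 - q) * m) ^ (m - t)
      \<le> (exp (q * m - real t) * real t ^ t) *
        (exp ((1 - q) * m - real (m - t)) * real (m - t) ^ (m - t))"
    using assms by (intro mult_mono power_le_exp_mult_power) auto
  also have "\<dots> = exp ((q * m - real t) + ((1 - q) * m - real (m - t))) *
      (real t ^ t * real (m - t) ^ (m - t))"
    by (simp only: exp_add) (simp add: ac_simps)
  also have "(q * m - real t) + ((1 - q) * m - real (m - t)) = 0"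
    using assms by (simp add: algebra_simps)
  finally have *: "(q * m) ^ t * ((1 - q) * m) ^ (m - t) \<le> real t ^ t * real (m - t) ^ (m - t)"
    by simp
  have mm: "real m ^ t * real m ^ (m - t) = real m ^ m"
    using assms by (simp add: power_add[symmetric])
  have "(q ^ t * (1 - q) ^ (m - t)) * real m ^ m = (q * m) ^ t * ((1 - q) * m) ^ (m - t)"
    by (simp add: power_mult_distrib mm[symmetric])
  also note *
  finally have "q ^ t * (1 - q) ^ (m - t)
      \<le> (real t ^ t * real (m - t) ^ (m - t)) / (real m ^ t * real m ^ (m - t))"
    using m by (simp add: mm pos_le_divide_eq)
  also have "\<dots> = (real t / real m) ^ t * (real (m - t) / real m) ^ (m - t)"
    by (simp add: power_divide)
  also have "real (m - t) / real m = 1 - real t / real m"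
    using assms m by (simp add: diff_divide_distrib)
  finally show ?thesis .
qed (use assms in simp)

section \<open>Counting subsets and pairs\<close>

lemma sum_Pow_card:
  fixes g :: "nat \<Rightarrow> 'b::comm_semiring_1"
  assumes "finite A"
  shows "(\<Sum>S\<in>Pow A. g (card S)) = (\<Sum>t=0..card A. of_nat (card A choose t) * g t)"
proof -
  have "(\<Sum>S\<in>Pow A. g (card S)) = (\<Sum>t\<in>{0..card A}. \<Sum>S\<in>{S \<in> Pow A. card S = t}. g (card S))"
    using assms by (intro sum.group[symmetric]) (auto intro: card_mono)
  also have "\<dots> = (\<Sum>t=0..card A. of_nat (card A choose t) * g t)"
    using assms by (intro sum.cong refl) (simp add: n_subsets)
  finally show ?thesis .
qed

text \<open>The square \<open>A \<times> A\<close> splits into the increasing pairs, their mirror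
  images and the diagonal.\<close>

lemma card_increasing_pairs:
  fixes A :: "'a::linorder set"
  assumes "finite A"
  shows "card {(i, j). i \<in> A \<and> j \<in> A \<and> i < j} = card A * (card A - 1) div 2"
proof -
  let ?L = "{(i, j). i \<in> A \<and> j \<in> A \<and> i < j}"
  have fin: "finite ?L" by (rule finite_subset[of _ "A \<times> A"]) (use assms in auto)
  have "A \<times> A = ?L \<union> prod.swap ` ?L \<union> (\<lambda>a. (a, a)) ` A"
    by (auto simp: image_iff)
  then have "card (A \<times> A) = card (?L \<union> prod.swap ` ?L \<union> (\<lambda>a. (a, a)) ` A)"
    by (rule arg_cong)
  also have "\<dots> = card (?L \<union> prod.swap ` ?L) + card ((\<lambda>a. (a, a)) ` A)"
    using fin assms by (intro card_Un_disjoint) auto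
  also have "card (?L \<union> prod.swap ` ?L) = card ?L + card (prod.swap ` ?L)"
    using fin by (intro card_Un_disjoint) auto
  also have "card (prod.swap ` ?L) = card ?L"
    by (rule card_image) simp
  also have "card ((\<lambda>a. (a, a)) ` A) = card A"
    by (rule card_image) (simp add: inj_on_def)
  finally have "card A * card A = 2 * card ?L + card A"
    by (simp add: card_cartesian_product)
  then have "card A * (card A - 1) = 2 * card ?L"
    by (simp add: diff_mult_distrib2)
  then show ?thesis by simp
qed

section \<open>Edge counts as cardinalities\<close>

text \<open>The two blocks form a single argument so that it can index a product of sets. Distinct
  labels already orient a pair of nodes; within one block \<open>i < j\<close> does.\<close>

definition block_pairs :: "nat \<Rightarrow> (nat \<Rightarrow> nat) \<Rightarrow> nat \<times> nat \<Rightarrow> (nat \<times> nat) set" where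
  "block_pairs n z = (\<lambda>(a, b).
     {(i, j) \<in> {1..n} \<times> {1..n}. z i = a \<and> z j = b \<and> (a = b \<longrightarrow> i < j)})"

lemma finite_block_pairs [simp]: "finite (block_pairs n z p)"
  by (rule finite_subset[of _ "{1..n} \<times> {1..n}"]) (auto simp: block_pairs_def split: prod.splits)

lemma block_size_eq_card: "block_size n z a = card {i \<in> {1..n}. z i = a}"
  by (simp add: block_size_def Int_def)

lemma card_block_pairs: "card (block_pairs n z (a, b)) = pair_count n z a b"
proof (cases "a = b")
  case True
  then have "block_pairs n z (a, b) =
      {(i, j). i \<in> {i \<in> {1..n}. z i = a} \<and> j \<in> {i \<in> {1..n}. z i = a} \<and> i < j}"
    by (auto simp: block_pairs_def)
  moreover have "finite {i \<in> {1..n}. z i = a}" by simp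
  ultimately have "card (block_pairs n z (a, b)) = block_size n z a * (block_size n z a - 1) div 2"
    by (simp only: card_increasing_pairs block_size_eq_card)
  with True show ?thesis by (simp only: pair_count_def refl if_True)
next
  case False
  then have "block_pairs n z (a, b) = {i \<in> {1..n}. z i = a} \<times> {i \<in> {1..n}. z i = b}"
    by (auto simp: block_pairs_def)
  with False show ?thesis
    by (simp only: card_cartesian_product pair_count_def block_size_eq_card if_False)
qed

lemma network_binary:
  assumes "x \<in> networks n" "i \<in> {1..n}" "j \<in> {1..n}"
  shows "x i j = 0 \<or> x i j = 1"
  using assms by (auto simp: networks_def PiE_iff)

text \<open>Entries are 0 or 1, so adding them counts the ones. Both cases of the definition are
  first brought to a sum over the full square of indices.\<close>

lemma edge_count_eq_card:
  assumes "x \<in> networks n"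
  shows "edge_count n x z a b = card {(i, j) \<in> block_pairs n z (a, b). x i j = 1}"
proof -
  have "edge_count n x z a b =
      (\<Sum>(i, j)\<in>{1..n} \<times> {1..n}. of_bool (x i j = 1 \<and> (i, j) \<in> block_pairs n z (a, b)))"
  proof (cases "a = b")
    case True
    have "edge_count n x z a b = (\<Sum>i=1..n. \<Sum>j\<in>{i<..n}. x i j * of_bool (z i = a \<and> z j = a))"
      using True by (simp add: edge_count_def)
    also have "\<dots> = (\<Sum>i=1..n. \<Sum>j=1..n. of_bool (x i j = 1 \<and> (i, j) \<in> block_pairs n z (a, b)))"
    proof (rule sum.cong[OF refl])
      fix i assume i: "i \<in> {1..n}"
      show "(\<Sum>j\<in>{i<..n}. x i j * of_bool (z i = a \<and> z j = a)) =
          (\<Sum>j=1..n. of_bool (x i j = 1 \<and> (i, j) \<in> block_pairs n z (a, b)))"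
      \<comment> \<open>The added terms with \<open>j \<le> i\<close> vanish because
        \<open>block_pairs\<close> demands \<open>i < j\<close> when \<open>a = b\<close>.\<close>
      proof (rule sum.mono_neutral_cong_left)
        show "x i j * of_bool (z i = a \<and> z j = a) =
            of_bool (x i j = 1 \<and> (i, j) \<in> block_pairs n z (a, b))" if "j \<in> {i<..n}" for j
          using True i that network_binary[OF assms, of i j] by (auto simp: block_pairs_def)
      qed (use True in \<open>auto simp: block_pairs_def\<close>)
    qed
    finally show ?thesis by (simp only: sum.cartesian_product)
  next
    case False
    have "edge_count n x z a b = (\<Sum>i=1..n. \<Sum>j=1..n. x i j * of_bool (z i = a \<and> z j = b))"
      using False by (simp add: edge_count_def)
    also have "\<dots> = (\<Sum>i=1..n. \<Sum>j=1..n. of_bool (x i j = 1 \<and> (i, j) \<in> block_pairs n z (a, b)))"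
    proof (intro sum.cong refl)
      fix i j assume "i \<in> {1..n}" "j \<in> {1..n}"
      with False show "x i j * of_bool (z i = a \<and> z j = b) =
          of_bool (x i j = 1 \<and> (i, j) \<in> block_pairs n z (a, b))"
        using network_binary[OF assms, of i j] by (auto simp: block_pairs_def)
    qed
    finally show ?thesis by (simp only: sum.cartesian_product)
  qed
  also have "\<dots> = (\<Sum>e\<in>{1..n} \<times> {1..n}. of_bool (e \<in> {(i, j) \<in> block_pairs n z (a, b). x i j = 1}))"
    by (intro sum.cong refl) auto
  also have "\<dots> = card {(i, j) \<in> block_pairs n z (a, b). x i j = 1}"
    by (simp, rule arg_cong[of _ _ card]) (auto simp: block_pairs_def)
  finally show ?thesis .
qed

section \<open>Networks as families of edge sets\<close>

text \<open>The restriction to \<open>a \<le> b\<close> makes the family extensional, as membership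
  in a \<open>PiE\<close> set requires.\<close>

definition block_edges ::
    "nat \<Rightarrow> nat \<Rightarrow> (nat \<Rightarrow> nat) \<Rightarrow> (nat \<Rightarrow> nat \<Rightarrow> nat) \<Rightarrow> nat \<times> nat \<Rightarrow> (nat \<times> nat) set" where
  "block_edges n k z x =
     (\<lambda>p \<in> (SIGMA a:{1..k}. {a..k}). {(i, j) \<in> block_pairs n z p. x i j = 1})"

definition assemble_network :: "nat \<Rightarrow> (nat \<times> nat) set \<Rightarrow> nat \<Rightarrow> nat \<Rightarrow> nat" where
  "assemble_network n U = (\<lambda>i\<in>{1..n}. \<lambda>j\<in>{1..n}. of_bool ((i, j) \<in> U \<or> (j, i) \<in> U))"

text \<open>The inverse joins the edge sets of a family and symmetrises the result. It works because
  two distinct nodes have exactly one orientation that lies in some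
  \<open>block_pairs n z p\<close>, and \<open>p\<close> is then determined by their labels.\<close>

lemma bij_betw_block_edges:
  assumes z: "z \<in> {1..n} \<rightarrow> {1..k}"
  shows "bij_betw (block_edges n k z) (networks n)
    (\<Pi>\<^sub>E p\<in>(SIGMA a:{1..k}. {a..k}). Pow (block_pairs n z p))"
proof -
  let ?I = "SIGMA a:{1..k}. {a..k}"
  have zk: "z i \<in> {1..k}" if "i \<in> {1..n}" for i
    using z that by auto
  show ?thesis
  proof (rule bij_betwI[where g = "\<lambda>f. assemble_network n (\<Union>p\<in>?I. f p)"])
    show "block_edges n k z \<in> networks n \<rightarrow> (\<Pi>\<^sub>E p\<in>?I. Pow (block_pairs n z p))"
      unfolding block_edges_def by (rule Pi_I, subst restrict_PiE_iff) auto
  next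
    show "(\<lambda>f. assemble_network n (\<Union>p\<in>?I. f p)) \<in> (\<Pi>\<^sub>E p\<in>?I. Pow (block_pairs n z p)) \<rightarrow> networks n"
    proof
      fix f assume f: "f \<in> (\<Pi>\<^sub>E p\<in>?I. Pow (block_pairs n z p))"
      \<comment> \<open>A loop would have equal labels and hence need \<open>i < i\<close>; this
        gives the zero diagonal.\<close>
      have "(i, i) \<notin> f p" if "p \<in> ?I" for i p
        using PiE_mem[OF f that] by (auto simp: block_pairs_def split: prod.splits)
      then show "assemble_network n (\<Union>p\<in>?I. f p) \<in> networks n"
        by (auto simp: networks_def assemble_network_def)
    qed
  next
    fix x assume x: "x \<in> networks n"
    have xE: "x \<in> {1..n} \<rightarrow>\<^sub>E ({1..n} \<rightarrow>\<^sub>E {0, 1})"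
      and xs: "\<And>i j. i \<in> {1..n} \<Longrightarrow> j \<in> {1..n} \<Longrightarrow> x i j = x j i"
      and xd: "\<And>i. i \<in> {1..n} \<Longrightarrow> x i i = 0"
      using x by (auto simp: networks_def)
    let ?U = "\<Union>p\<in>?I. block_edges n k z x p"
    \<comment> \<open>The labels lie in \<open>{1..k}\<close>, so every edge, oriented this way, has
      its label pair in \<open>?I\<close> and none is lost.\<close>
    have U: "(i, j) \<in> ?U \<longleftrightarrow> x i j = 1 \<and> (z i < z j \<or> z i = z j \<and> i < j)"
      if "i \<in> {1..n}" "j \<in> {1..n}" for i j
      using zk[OF that(1)] zk[OF that(2)] that
      by (fastforce simp: block_edges_def block_pairs_def)
    show "assemble_network n ?U = x"
    proof (intro ext)
      fix i j
      consider "i \<notin> {1..n}" | "i \<in> {1..n}" "j \<notin> {1..n}" | "i \<in> {1..n}" "j \<in> {1..n}"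
        by blast
      then show "assemble_network n ?U i j = x i j"
      proof cases
        case 1
        then have "x i = undefined" using xE by (rule PiE_arb[rotated])
        with 1 show ?thesis by (simp only: assemble_network_def restrict_apply if_False)
      next
        case 2
        have "x i j = undefined" using PiE_arb[OF PiE_mem[OF xE 2(1)] 2(2)] .
        with 2 show ?thesis by (simp only: assemble_network_def restrict_apply if_True if_False)
      next
        case 3
        have "assemble_network n ?U i j = of_bool ((i, j) \<in> ?U \<or> (j, i) \<in> ?U)"
          using 3 by (simp add: assemble_network_def)
        \<comment> \<open>For \<open>i \<noteq> j\<close> exactly one orientation meets the order
          condition; for \<open>i = j\<close> both sides are false.\<close>
        also have "((i, j) \<in> ?U \<or> (j, i) \<in> ?U) \<longleftrightarrow> x i j = 1"
          unfolding U[OF 3] U[OF 3(2) 3(1)] using xs[OF 3] xd[OF 3(1)]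
          by (cases "i = j") auto
        finally show ?thesis using network_binary[OF x 3] by auto
      qed
    qed
  next
    fix f assume f: "f \<in> (\<Pi>\<^sub>E p\<in>?I. Pow (block_pairs n z p))"
    let ?U = "\<Union>p\<in>?I. f p"
    \<comment> \<open>The endpoints determine \<open>p\<close>, so the sets \<open>f p\<close> are
      disjoint and can be recovered from their union.\<close>
    have fD: "i \<in> {1..n}" "j \<in> {1..n}" "p = (z i, z j)" "z i < z j \<or> z i = z j \<and> i < j"
      if "p \<in> ?I" "(i, j) \<in> f p" for p i j
      using PiE_mem[OF f that(1)] that by (auto simp: block_pairs_def)
    show "block_edges n k z (assemble_network n ?U) = f"
    proof
      fix p
      show "block_edges n k z (assemble_network n ?U) p = f p"
      proof (cases "p \<in> ?I")
        case False
        then show ?thesis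
          using PiE_arb[OF f False] unfolding block_edges_def by simp
      next
        case True
        have sub: "f p \<subseteq> block_pairs n z p" using PiE_mem[OF f True] by simp
        have "assemble_network n ?U i j = 1 \<longleftrightarrow> (i, j) \<in> f p" if ij: "(i, j) \<in> block_pairs n z p" for i j
        proof -
          have p: "i \<in> {1..n}" "j \<in> {1..n}" "p = (z i, z j)" "z i < z j \<or> z i = z j \<and> i < j"
            using ij True by (auto simp: block_pairs_def)
          have "(i, j) \<in> ?U \<longleftrightarrow> (i, j) \<in> f p"
            using fD(3) True p(3) by blast
          \<comment> \<open>The reversed pair violates the order condition, so symmetrising adds
            nothing to \<open>f p\<close>.\<close>
          moreover have "(j, i) \<notin> ?U"
            using fD(4)[of _ j i] p(4) by (metis UN_E less_asym)
          ultimately show ?thesis using p(1,2) by (simp add: assemble_network_def)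
        qed
        then show ?thesis
          using True sub by (auto simp: block_edges_def)
      qed
    qed
  qed
qed

section \<open>The supremum over probability matrices\<close>

text \<open>The entries with \<open>a \<le> b\<close> can be chosen independently and each occurs in
  one factor, so the factorwise maximisers form a single matrix that attains the supremum.\<close>

lemma SUP_sbm_prob:
  fixes n k :: nat and z :: "nat \<Rightarrow> nat"
  assumes "\<And>a b. edge_count n x z a b \<le> pair_count n z a b"
  shows "(SUP P\<in>prob_matrices k. sbm_prob n k P x z) =
    (\<Prod>(a, b)\<in>(SIGMA a:{1..k}. {a..k}).
       (real (edge_count n x z a b) / real (pair_count n z a b)) ^ edge_count n x z a b *
       (1 - real (edge_count n x z a b) / real (pair_count n z a b))
         ^ (pair_count n z a b - edge_count n x z a b))"
    (is "_ = ?M")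
proof -
  let ?q = "\<lambda>a b. real (edge_count n x z a b) / real (pair_count n z a b)"
  have prob: "sbm_prob n k P x z = (\<Prod>(a, b)\<in>(SIGMA a:{1..k}. {a..k}).
      P a b ^ edge_count n x z a b * (1 - P a b) ^ (pair_count n z a b - edge_count n x z a b))" for P
    by (simp add: sbm_prob_def prod.Sigma)
  \<comment> \<open>For an empty set of pairs the quotient is 0 / 0 = 0, still a
    probability.\<close>
  have q: "0 \<le> ?q a b" "?q a b \<le> 1" for a b
    using assms[of a b] by (auto simp: divide_le_eq_1)
  \<comment> \<open>\<open>min\<close> and \<open>max\<close> extend the entries with
    \<open>a \<le> b\<close> to a symmetric matrix.\<close>
  define Q where "Q = (\<lambda>a\<in>{1..k}. \<lambda>b\<in>{1..k}. ?q (min a b) (max a b))"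
  have "Q \<in> prob_matrices k"
    using q by (auto simp: prob_matrices_def Q_def min.commute max.commute)
  moreover have "?M = sbm_prob n k Q x z"
    unfolding prob by (intro prod.cong refl) (auto simp: Q_def)
  ultimately have "?M \<in> (\<lambda>P. sbm_prob n k P x z) ` prob_matrices k"
    by (intro image_eqI[where x = Q])
  moreover have "sbm_prob n k P x z \<le> ?M" if P: "P \<in> prob_matrices k" for P
  proof -
    have P01: "0 \<le> P a b" "P a b \<le> 1" if "a \<in> {1..k}" "b \<in> {a..k}" for a b
    proof -
      have "P \<in> {1..k} \<rightarrow>\<^sub>E ({1..k} \<rightarrow>\<^sub>E {0..1})" using P by (simp add: prob_matrices_def)
      moreover have "b \<in> {1..k}" using that by auto
      ultimately have "P a b \<in> {0..1}" using that by (meson PiE_mem)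
      then show "0 \<le> P a b" "P a b \<le> 1" by auto
    qed
    show ?thesis
      unfolding prob
    proof (rule prod_mono, clarify)
      fix a b assume "a \<in> {1..k}" "b \<in> {a..k}"
      note * = P01[OF this]
      show "0 \<le> P a b ^ edge_count n x z a b * (1 - P a b) ^ (pair_count n z a b - edge_count n x z a b) \<and>
          P a b ^ edge_count n x z a b * (1 - P a b) ^ (pair_count n z a b - edge_count n x z a b)
          \<le> ?q a b ^ edge_count n x z a b * (1 - ?q a b) ^ (pair_count n z a b - edge_count n x z a b)"
        using * bernoulli_likelihood_le[OF * assms] by simp
    qed
  qed
  ultimately show ?thesis
    by (intro cSup_eq_maximum) auto
qed

section \<open>Factorization of the sum over networks\<close>

lemma C_MN2_altdef:
  "C_MN2 m = (\<Sum>t=0..m. of_nat (m choose t) *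
     ((real t / real m) ^ t * (1 - real t / real m) ^ (m - t)))"
  unfolding C_MN2_def
proof (intro sum.cong refl)
  fix t assume "t \<in> {0..m}"
  then have t: "t \<le> m" by simp
  \<comment> \<open>For \<open>m = 0\<close> the bases are 0 and 1, but the exponent is 0, so the
    powers agree.\<close>
  have "(real (m - t) / real m) ^ (m - t) = (1 - real t / real m) ^ (m - t)"
    using t by (cases "m = 0") (auto simp: diff_divide_distrib)
  then show "fact m / (fact t * fact (m - t)) * (real t / real m) ^ t * (real (m - t) / real m) ^ (m - t)
      = of_nat (m choose t) * ((real t / real m) ^ t * (1 - real t / real m) ^ (m - t))"
    using binomial_fact[OF t, where 'a = real] by simp
qed

theorem proposition4p1:
  fixes n k :: nat and z :: "nat \<Rightarrow> nat"
  assumes "n \<ge> 1" and "k \<ge> 1" and "z \<in> {1..n} \<rightarrow> {1..k}"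
  shows "C_DNML n z k = (\<Prod>a=1..k. \<Prod>b=a..k. C_MN2 (pair_count n z a b))"
proof -
  let ?I = "SIGMA a:{1..k}. {a..k}"
  \<comment> \<open>\<open>g m t\<close> is the maximal likelihood of \<open>t\<close> edges among
    \<open>m\<close> pairs.\<close>
  define g where "g = (\<lambda>m t. (real t / real m) ^ t * (1 - real t / real m) ^ (m - t))"
  define m where "m = (\<lambda>p. card (block_pairs n z p))"
  have "C_DNML n z k = (\<Sum>x\<in>networks n. \<Prod>p\<in>?I. g (m p) (card (block_edges n k z x p)))"
    unfolding C_DNML_def
  proof (intro sum.cong refl)
    fix x assume x: "x \<in> networks n"
    have "edge_count n x z a b \<le> pair_count n z a b" for a b
      unfolding edge_count_eq_card[OF x] card_block_pairs[symmetric]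
      by (intro card_mono) auto
    from SUP_sbm_prob[OF this]
    show "(SUP P\<in>prob_matrices k. sbm_prob n k P x z) =
        (\<Prod>p\<in>?I. g (m p) (card (block_edges n k z x p)))"
      by (auto simp: g_def m_def card_block_pairs block_edges_def edge_count_eq_card[OF x]
          intro!: prod.cong)
  qed
  \<comment> \<open>The summand depends on \<open>x\<close> only through
    \<open>block_edges n k z x\<close>, so the sum can be carried over to families.\<close>
  also have "\<dots> = (\<Sum>f\<in>(\<Pi>\<^sub>E p\<in>?I. Pow (block_pairs n z p)). \<Prod>p\<in>?I. g (m p) (card (f p)))"
    by (rule sum.reindex_bij_betw[OF bij_betw_block_edges[OF assms(3)]])
  also have "\<dots> = (\<Prod>p\<in>?I. \<Sum>S\<in>Pow (block_pairs n z p). g (m p) (card S))"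
    by (rule prod_sum_PiE[symmetric]) auto
  also have "\<dots> = (\<Prod>p\<in>?I. C_MN2 (m p))"
    by (intro prod.cong refl)
       (simp only: m_def C_MN2_altdef g_def[symmetric] sum_Pow_card finite_block_pairs, simp add: g_def)
  also have "\<dots> = (\<Prod>(a, b)\<in>?I. C_MN2 (pair_count n z a b))"
    by (intro prod.cong refl) (auto simp: m_def card_block_pairs)
  also have "\<dots> = (\<Prod>a=1..k. \<Prod>b=a..k. C_MN2 (pair_count n z a b))"
    by (simp add: prod.Sigma)
  finally show ?thesis .
qed

end
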